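(* When the condition $D_\Omega(\theta\|\theta')\ge 0$ holds for any $\theta,\theta'$ in $\mathcal M$, the Bregman-divergence-based Arimoto–Blahut algorithm is the same as the mirror descent algorithm.
   Context: Bregman system: $\Theta\subset\mathbb R^d$ is an open convex set and $\phi:\Theta\to\mathbb R$ is a $C^2$ strictly convex function. For $\theta\in\Theta$ put $\eta_j(\theta):=\frac{\partial\phi}{\partial\theta^j}(\theta)$ and $\eta(\theta)=(\eta_1(\theta),\dots,\eta_d(\theta))$; this map is one-to-one, and its inverse on its range is written $\eta\mapsto\theta(\eta)$. The Bregman divergence is $$D^\phi(\theta_1\|\theta_2):=\sum_{j=1}^d\eta_j(\theta_1)(\theta_1^j-\theta_2^j)-\phi(\theta_1)+\phi(\theta_2),\qquad \theta_1,\theta_2\in\Theta.$$ Mixture family: with $k=d-d_0$ and $c\in\mathbb R^k$, $\mathcal M:=\{\theta\in\Theta:\ \frac{\partial\phi}{\partial\theta^{d_0+j}}(\theta)=c_j,\ j=1,\dots,k\}$. On $\mathcal D:=\{\eta(\theta):\theta\in\mathcal M\}\subset\mathbb R^d$ the coordinates $\eta_1,\dots,\eta_{d_0}$ are free parameters and $\eta_{d_0+1},\dots,\eta_d$ are fixed to the constants $c_1,\dots,c_k$. The set $\mathcal D$ is convex. Objective function: $\tilde\Omega=(\tilde\Omega^1,\dots,\tilde\Omega^d):\mathcal D\to\mathbb R^d$ is a function, $\tilde{\mathcal G}(\eta):=\sum_{j=1}^d\eta_j\tilde\Omega^j(\eta)$ is to be minimized over $\eta\in\mathcal D$, and $\Omega(\theta):=\tilde\Omega(\eta(\theta))$.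 Define $D_\Omega(\theta\|\theta'):=\sum_{j=1}^d\eta_j(\theta)\big(\Omega^j(\theta)-\Omega^j(\theta')\big)$. Bregman-divergence-based Arimoto–Blahut algorithm (with parameter $\gamma>0$): choose $\theta^{[1]}\in\mathcal M$ and iterate $\theta^{[t+1]}:=\Gamma^{(e),\phi}_{\mathcal M}(\mathcal F_\gamma(\theta^{[t]}))$, where $\mathcal F_\gamma(\theta):=\theta-\frac1\gamma\Omega(\theta)$ takes values in $\Theta$ and $\Gamma^{(e),\phi}_{\mathcal M}(\bar\theta):=\operatorname{argmin}_{\theta'\in\mathcal M}D^\phi(\theta'\|\bar\theta)$. Mirror descent algorithm (with a step-size parameter $\beta>0$ to be chosen): choose $\eta_{[1]}\in\mathcal D$ and iterate $$\eta_{[t+1]}:=\operatorname{argmin}_{\eta\in\mathcal D}\ \sum_{j=1}^{d_0}\eta_j\frac{\partial\tilde{\mathcal G}}{\partial\eta_j}(\eta_{[t]})+\frac1\beta D^\phi(\theta(\eta)\|\theta(\eta_{[t]})).$$ The iterates of the two algorithms are compared through the correspondence $\theta\leftrightarrow\eta(\theta)$. *)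

theory Defs
  imports "HOL-Analysis.Analysis"
begin

definition strictly_convex_on :: "'a::real_vector set \<Rightarrow> ('a \<Rightarrow> real) \<Rightarrow> bool" where
  "strictly_convex_on S f \<longleftrightarrow> convex S \<and>
     (\<forall>x\<in>S. \<forall>y\<in>S. \<forall>u>0. \<forall>v>0. x \<noteq> y \<longrightarrow> u + v = 1 \<longrightarrow>
        f (u *\<^sub>R x + v *\<^sub>R y) < u * f x + v * f y)"

(* Gradient g and Hessian matrix H exist on S and H is continuous; intended for open S. *)
definition C2_on :: "(real^'d) set \<Rightarrow> (real^'d \<Rightarrow> real) \<Rightarrow> bool" where
  "C2_on S f \<longleftrightarrow> (\<exists>(g :: real^'d \<Rightarrow> real^'d) (H :: real^'d \<Rightarrow> real^'d^'d).
     (\<forall>x\<in>S. (f has_derivative (\<lambda>h. g x \<bullet> h)) (at x)) \<and>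
     (\<forall>x\<in>S. (g has_derivative (\<lambda>h. H x *v h)) (at x)) \<and>
     continuous_on S H)"

(* Two-sided partial derivatives, which depend only on the values of f on the line
   through x in the j-th coordinate direction. *)
definition has_partial :: "'d \<Rightarrow> (real^'d \<Rightarrow> real) \<Rightarrow> real^'d \<Rightarrow> bool" where
  "has_partial j f x \<longleftrightarrow> (\<lambda>t::real. f (x + t *\<^sub>R axis j 1)) field_differentiable (at 0)"

definition partial :: "'d \<Rightarrow> (real^'d \<Rightarrow> real) \<Rightarrow> real^'d \<Rightarrow> real" where
  "partial j f x = deriv (\<lambda>t::real. f (x + t *\<^sub>R axis j 1)) 0"

definition eta :: "(real^'d \<Rightarrow> real) \<Rightarrow> real^'d \<Rightarrow> real^'d" where
  "eta \<phi> \<theta> = (\<chi> j. partial j \<phi> \<theta>)"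

(* Inverse of eta on its range; unspecified outside of eta \<phi> ` \<Theta>. *)
definition theta_of :: "(real^'d) set \<Rightarrow> (real^'d \<Rightarrow> real) \<Rightarrow> real^'d \<Rightarrow> real^'d" where
  "theta_of \<Theta> \<phi> = inv_into \<Theta> (eta \<phi>)"

definition bregman_div :: "(real^'d \<Rightarrow> real) \<Rightarrow> real^'d \<Rightarrow> real^'d \<Rightarrow> real" where
  "bregman_div \<phi> \<theta>1 \<theta>2 = (\<Sum>j\<in>UNIV. eta \<phi> \<theta>1 $ j * (\<theta>1 $ j - \<theta>2 $ j)) - \<phi> \<theta>1 + \<phi> \<theta>2"

(* J is the set of free coordinates, d0 = card J. An index type carries no order, so
   "the first d0 coordinates" is rendered as an arbitrary set of coordinates.
   The values of c on J are irrelevant. *)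
definition mixture_family ::
    "(real^'d) set \<Rightarrow> (real^'d \<Rightarrow> real) \<Rightarrow> 'd set \<Rightarrow> ('d \<Rightarrow> real) \<Rightarrow> (real^'d) set" where
  "mixture_family \<Theta> \<phi> J c = {\<theta>\<in>\<Theta>. \<forall>i. i \<notin> J \<longrightarrow> partial i \<phi> \<theta> = c i}"

definition mixture_domain ::
    "(real^'d) set \<Rightarrow> (real^'d \<Rightarrow> real) \<Rightarrow> 'd set \<Rightarrow> ('d \<Rightarrow> real) \<Rightarrow> (real^'d) set" where
  "mixture_domain \<Theta> \<phi> J c = eta \<phi> ` mixture_family \<Theta> \<phi> J c"

(* W maps mixture coordinates to R^d; only its values on the mixture domain matter. *)
definition objective :: "(real^'d \<Rightarrow> real^'d) \<Rightarrow> real^'d \<Rightarrow> real" where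
  "objective W y = (\<Sum>j\<in>UNIV. y $ j * W y $ j)"

definition Omega :: "(real^'d \<Rightarrow> real) \<Rightarrow> (real^'d \<Rightarrow> real^'d) \<Rightarrow> real^'d \<Rightarrow> real^'d" where
  "Omega \<phi> W \<theta> = W (eta \<phi> \<theta>)"

definition D_Omega ::
    "(real^'d \<Rightarrow> real) \<Rightarrow> (real^'d \<Rightarrow> real^'d) \<Rightarrow> real^'d \<Rightarrow> real^'d \<Rightarrow> real" where
  "D_Omega \<phi> W \<theta> \<theta>' =
     (\<Sum>j\<in>UNIV. eta \<phi> \<theta> $ j * (Omega \<phi> W \<theta> $ j - Omega \<phi> W \<theta>' $ j))"

definition F_map ::
    "(real^'d \<Rightarrow> real) \<Rightarrow> (real^'d \<Rightarrow> real^'d) \<Rightarrow> real \<Rightarrow> real^'d \<Rightarrow> real^'d" where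
  "F_map \<phi> W \<gamma> \<theta> = \<theta> - (1 / \<gamma>) *\<^sub>R Omega \<phi> W \<theta>"

(* The steps are relations ("\<theta>' is a minimiser"), so that neither existence nor
   uniqueness of the minimiser is presupposed. *)
definition e_projection ::
    "(real^'d) set \<Rightarrow> (real^'d \<Rightarrow> real) \<Rightarrow> 'd set \<Rightarrow> ('d \<Rightarrow> real) \<Rightarrow>
     real^'d \<Rightarrow> real^'d \<Rightarrow> bool" where
  "e_projection \<Theta> \<phi> J c \<theta>bar \<theta>' \<longleftrightarrow>
     is_arg_min (\<lambda>\<theta>. bregman_div \<phi> \<theta> \<theta>bar) (\<lambda>\<theta>. \<theta> \<in> mixture_family \<Theta> \<phi> J c) \<theta>'"

definition ab_step ::
    "(real^'d) set \<Rightarrow> (real^'d \<Rightarrow> real) \<Rightarrow> 'd set \<Rightarrow> ('d \<Rightarrow> real) \<Rightarrow> (real^'d \<Rightarrow> real^'d) \<Rightarrow>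
     real \<Rightarrow> real^'d \<Rightarrow> real^'d \<Rightarrow> bool" where
  "ab_step \<Theta> \<phi> J c W \<gamma> \<theta> \<theta>' \<longleftrightarrow> e_projection \<Theta> \<phi> J c (F_map \<phi> W \<gamma> \<theta>) \<theta>'"

definition md_step ::
    "(real^'d) set \<Rightarrow> (real^'d \<Rightarrow> real) \<Rightarrow> 'd set \<Rightarrow> ('d \<Rightarrow> real) \<Rightarrow> (real^'d \<Rightarrow> real^'d) \<Rightarrow>
     real \<Rightarrow> real^'d \<Rightarrow> real^'d \<Rightarrow> bool" where
  "md_step \<Theta> \<phi> J c W \<beta> y y' \<longleftrightarrow>
     is_arg_min
       (\<lambda>z. (\<Sum>j\<in>J. z $ j * partial j (objective W) y)
            + (1 / \<beta>) * bregman_div \<phi> (theta_of \<Theta> \<phi> z) (theta_of \<Theta> \<phi> y))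
       (\<lambda>z. z \<in> mixture_domain \<Theta> \<phi> J c) y'"

definition ab_sequence ::
    "(real^'d) set \<Rightarrow> (real^'d \<Rightarrow> real) \<Rightarrow> 'd set \<Rightarrow> ('d \<Rightarrow> real) \<Rightarrow> (real^'d \<Rightarrow> real^'d) \<Rightarrow>
     real \<Rightarrow> (nat \<Rightarrow> real^'d) \<Rightarrow> bool" where
  "ab_sequence \<Theta> \<phi> J c W \<gamma> \<theta> \<longleftrightarrow>
     \<theta> 0 \<in> mixture_family \<Theta> \<phi> J c \<and> (\<forall>t. ab_step \<Theta> \<phi> J c W \<gamma> (\<theta> t) (\<theta> (Suc t)))"

definition md_sequence ::
    "(real^'d) set \<Rightarrow> (real^'d \<Rightarrow> real) \<Rightarrow> 'd set \<Rightarrow> ('d \<Rightarrow> real) \<Rightarrow> (real^'d \<Rightarrow> real^'d) \<Rightarrow>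
     real \<Rightarrow> (nat \<Rightarrow> real^'d) \<Rightarrow> bool" where
  "md_sequence \<Theta> \<phi> J c W \<beta> y \<longleftrightarrow>
     y 0 \<in> mixture_domain \<Theta> \<phi> J c \<and> (\<forall>t. md_step \<Theta> \<phi> J c W \<beta> (y t) (y (Suc t)))"

end

theory Submission
  imports Defs
begin

text \<open>The hypothesis on \<open>D_Omega\<close> says that \<open>W y\<close> is a subgradient of the objective at every \<open>y\<close> in the
  mixture domain. By invariance of domain the gradient map has open range, so the mixture domain
  is relatively open in the free coordinates and the subgradient coordinates are forced to equal
  the partial derivatives. Expanding the Bregman divergence, the two step functionals then agree
  up to the factor \<open>\<gamma>\<close> and an additive constant, with step size \<open>\<beta> = 1 / \<gamma>\<close>.\<close>

section \<open>Gradients and subgradients of convex functions\<close>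

lemma strictly_convex_on_imp_convex_on:
  assumes "strictly_convex_on S f"
  shows "convex_on S f"
proof (rule convex_onI)
  fix t :: real and x y assume t: "0 < t" "t < 1" and xy: "x \<in> S" "y \<in> S"
  show "f ((1 - t) *\<^sub>R x + t *\<^sub>R y) \<le> (1 - t) * f x + t * f y"
  proof (cases "x = y")
    case True
    then show ?thesis by (simp flip: scaleR_add_left distrib_right)
  next
    case False
    then show ?thesis
      using assms t xy unfolding strictly_convex_on_def
      by (metis diff_gt_0_iff_gt less_imp_le diff_add_cancel)
  qed
qed (use assms in \<open>simp add: strictly_convex_on_def\<close>)

lemma partial_eqI:
  assumes "((\<lambda>t. f (x + t *\<^sub>R axis j 1)) has_real_derivative D) (at 0)"
  shows "partial j f x = D"
  unfolding partial_def using assms by (rule DERIV_imp_deriv)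

lemma has_real_derivative_along_line:
  fixes f :: "'a::real_inner \<Rightarrow> real"
  assumes "(f has_derivative (\<lambda>h. g \<bullet> h)) (at x)"
  shows "((\<lambda>t. f (x + t *\<^sub>R v)) has_real_derivative g \<bullet> v) (at 0)"
proof -
  have "((\<lambda>t. x + t *\<^sub>R v) has_derivative (\<lambda>t. t *\<^sub>R v)) (at (0::real))"
    by (auto intro!: derivative_eq_intros)
  then have "((\<lambda>t. f (x + t *\<^sub>R v)) has_derivative (\<lambda>t. g \<bullet> (t *\<^sub>R v))) (at 0)"
    using has_derivative_compose[of "\<lambda>t. x + t *\<^sub>R v" "\<lambda>t. t *\<^sub>R v" 0 UNIV f "\<lambda>h. g \<bullet> h"] assms by simp
  then show ?thesis
    by (simp add: has_field_derivative_def mult.commute[of _ "g \<bullet> v"])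
qed

text \<open>\<open>C2_on\<close> supplies an anonymous gradient, while \<open>eta\<close> is built
  from derivatives along coordinate lines; this identifies the two.\<close>

lemma eta_eq_gradient:
  assumes "(\<phi> has_derivative (\<lambda>h. g \<bullet> h)) (at x)"
  shows "eta \<phi> x = g"
  using partial_eqI[OF has_real_derivative_along_line[OF assms]]
  by (simp add: eta_def vec_eq_iff inner_axis)

text \<open>Restricting \<open>f\<close> to the line from \<open>x\<close> to \<open>y\<close>
  reduces this to the one-variable tangent inequality at 0, evaluated at 1.\<close>

lemma convex_on_above_tangent_plane:
  fixes f :: "'a::real_inner \<Rightarrow> real"
  assumes "open S" and f: "convex_on S f" and "x \<in> S" "y \<in> S"
    and der: "(f has_derivative (\<lambda>h. g \<bullet> h)) (at x)"
  shows "f y \<ge> f x + g \<bullet> (y - x)"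
proof -
  define l where "l = (\<lambda>t::real. x + t *\<^sub>R (y - x))"
  define A where "A = l -` S"
  have l: "l (u * s + v * t) = u *\<^sub>R l s + v *\<^sub>R l t" if "u + v = 1" for u v s t
  proof -
    have "u *\<^sub>R l s + v *\<^sub>R l t = (u + v) *\<^sub>R x + (u * s + v * t) *\<^sub>R (y - x)"
      by (simp add: l_def algebra_simps)
    with that show ?thesis by (simp add: l_def)
  qed
  \<comment> \<open>Openness puts 0 into the interior of \<open>A\<close>, as the one-variable
    inequality demands.\<close>
  have "open A"
    unfolding A_def l_def by (rule open_vimage[OF \<open>open S\<close>]) (intro continuous_intros)
  have S: "convex S" using f by (rule convex_on_imp_convex)
  have A: "convex A"
    using S by (auto simp: convex_def A_def l)
  have "convex_on A (\<lambda>t. f (l t))"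
    using A f by (auto simp: convex_on_def A_def l)
  moreover have "connected A" using A by (rule convex_connected)
  moreover have "0 \<in> interior A" "1 \<in> A"
    using \<open>open A\<close> assms by (simp_all add: interior_open A_def l_def)
  moreover have "((\<lambda>t. f (l t)) has_real_derivative g \<bullet> (y - x)) (at 0 within A)"
    unfolding l_def by (rule DERIV_subset[OF has_real_derivative_along_line[OF der]]) simp
  ultimately have "f (l 1) - f (l 0) \<ge> (g \<bullet> (y - x)) * (1 - 0)"
    by (rule convex_on_imp_above_tangent)
  then show ?thesis by (simp add: l_def)
qed

text \<open>Equal gradients at \<open>x\<close> and \<open>y\<close> give parallel tangent planes.
  At the midpoint their linear terms cancel in the average, so \<open>f m\<close> is at least the
  mean of \<open>f x\<close> and \<open>f y\<close>, against strict convexity.\<close>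

lemma strictly_convex_on_gradient_inj:
  fixes f :: "'a::real_inner \<Rightarrow> real"
  assumes "open S" and f: "strictly_convex_on S f"
    and der: "\<And>x. x \<in> S \<Longrightarrow> (f has_derivative (\<lambda>h. g x \<bullet> h)) (at x)"
  shows "inj_on g S"
proof (rule inj_onI, rule ccontr)
  fix x y assume xy: "x \<in> S" "y \<in> S" and eq: "g x = g y" and ne: "x \<noteq> y"
  define m where "m = (1/2) *\<^sub>R x + (1/2) *\<^sub>R y"
  have half: "(1/2::real) > 0" "1/2 + 1/2 = (1::real)" by simp_all
  have "m \<in> S"
    using f xy half unfolding strictly_convex_on_def convex_def m_def by (meson less_imp_le)
  note c = convex_on_above_tangent_plane[OF \<open>open S\<close> strictly_convex_on_imp_convex_on[OF f] _ \<open>m \<in> S\<close> der]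
  have "f m < 1/2 * f x + 1/2 * f y"
    using f xy half ne unfolding strictly_convex_on_def m_def by meson
  moreover have "f m \<ge> f x + g x \<bullet> (m - x)" "f m \<ge> f y + g x \<bullet> (m - y)"
    using c[of x] c[of y] xy eq by simp_all
  moreover have "g x \<bullet> (m - x) + g x \<bullet> (m - y) = 0"
  proof -
    have "(m - x) + (m - y) = 0"
      unfolding m_def by (simp add: algebra_simps flip: scaleR_2)
    then show ?thesis by (metis inner_add_right inner_zero_right)
  qed
  ultimately show False by linarith
qed

text \<open>Subtracting the linear minorant leaves a function of \<open>t\<close> with a local
  minimum at 0, so its derivative vanishes there.\<close>

lemma partial_eq_subgradient:
  assumes part: "has_partial j f y" and "d > 0"
    and sub: "\<And>t. \<bar>t\<bar> < d \<Longrightarrow> f (y + t *\<^sub>R axis j 1) \<ge> f y + t * w"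
  shows "partial j f y = w"
proof -
  let ?h = "\<lambda>t::real. f (y + t *\<^sub>R axis j 1)"
  obtain D where D: "(?h has_real_derivative D) (at 0)"
    using part unfolding has_partial_def field_differentiable_def by blast
  have "((\<lambda>t. ?h t - t * w) has_real_derivative D - w) (at 0)"
    using D by (auto intro!: derivative_eq_intros)
  then have "D - w = 0"
    by (rule DERIV_local_min[OF _ \<open>d > 0\<close>]) (use sub in \<open>fastforce simp: algebra_simps\<close>)
  with partial_eqI[OF D] show ?thesis by simp
qed

section \<open>Inner-product forms of the divergences and transport of minimizers\<close>

lemma bregman_div_inner:
  "bregman_div \<phi> \<theta>1 \<theta>2 = eta \<phi> \<theta>1 \<bullet> (\<theta>1 - \<theta>2) - \<phi> \<theta>1 + \<phi> \<theta>2"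
  by (simp add: bregman_div_def inner_vec_def)

text \<open>Since the objective at \<open>y\<close> is \<open>y \<bullet> W y\<close>, this form
  turns nonnegativity of \<open>D_Omega\<close> into a subgradient inequality with subgradient
  \<open>W (eta \<phi> \<theta>')\<close>.\<close>

lemma D_Omega_inner:
  "D_Omega \<phi> W \<theta> \<theta>' = objective W (eta \<phi> \<theta>) - eta \<phi> \<theta> \<bullet> W (eta \<phi> \<theta>')"
  by (simp add: D_Omega_def Omega_def objective_def inner_vec_def sum_subtractf right_diff_distrib)

lemma is_arg_min_affine_iff:
  fixes f g :: "'a \<Rightarrow> real"
  assumes "\<And>x. P x \<Longrightarrow> g x = a * f x + b" and "a > 0"
  shows "is_arg_min f P x \<longleftrightarrow> is_arg_min g P x"
  using assms by (auto simp: is_arg_min_linorder)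

lemma is_arg_min_image_iff:
  assumes "inj_on h A" and "x \<in> A"
  shows "is_arg_min f (\<lambda>z. z \<in> h ` A) (h x) \<longleftrightarrow> is_arg_min (\<lambda>x. f (h x)) (\<lambda>x. x \<in> A) x"
  using assms by (auto simp: is_arg_min_def)

section \<open>The gradient map of a Bregman system and the two step functionals\<close>

locale bregman_system =
  fixes \<Theta> :: "(real^'d) set" and \<phi> :: "real^'d \<Rightarrow> real"
  assumes open_dom: "open \<Theta>"
    and C2: "C2_on \<Theta> \<phi>"
    and strict: "strictly_convex_on \<Theta> \<phi>"
begin

lemma eta_derivative:
  assumes "x \<in> \<Theta>"
  shows "(\<phi> has_derivative (\<lambda>h. eta \<phi> x \<bullet> h)) (at x)"
  using C2 assms eta_eq_gradient unfolding C2_on_def by metis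

lemma inj_on_eta: "inj_on (eta \<phi>) \<Theta>"
  using open_dom strict eta_derivative by (rule strictly_convex_on_gradient_inj)

lemma continuous_on_eta: "continuous_on \<Theta> (eta \<phi>)"
proof -
  obtain g H where g: "\<forall>x\<in>\<Theta>. (\<phi> has_derivative (\<lambda>h. g x \<bullet> h)) (at x)"
    and H: "\<forall>x\<in>\<Theta>. (g has_derivative (\<lambda>h. H x *v h)) (at x)"
    using C2 unfolding C2_on_def by auto
  have "continuous_on \<Theta> g"
    using H has_derivative_continuous continuous_at_imp_continuous_on by blast
  moreover have "\<And>x. x \<in> \<Theta> \<Longrightarrow> g x = eta \<phi> x"
    using g eta_eq_gradient by metis
  ultimately show ?thesis
    using continuous_on_cong by metis
qed

text \<open>Strict convexity allows a degenerate Hessian, so the inverse function theorem does not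
  apply. Continuity and injectivity between spaces of equal dimension suffice for invariance of
  domain.\<close>

lemma open_eta_range: "open (eta \<phi> ` \<Theta>)"
  using continuous_on_eta open_dom inj_on_eta by (rule invariance_of_domain)

lemma theta_of_eta: "x \<in> \<Theta> \<Longrightarrow> theta_of \<Theta> \<phi> (eta \<phi> x) = x"
  by (simp add: theta_of_def inj_on_eta)

lemma inj_on_eta_mixture: "inj_on (eta \<phi>) (mixture_family \<Theta> \<phi> J c)"
  using inj_on_eta by (rule inj_on_subset) (auto simp: mixture_family_def)

text \<open>Presents the mixture domain as an open set cut by an affine coordinate subspace.\<close>

lemma mixture_domain_eq:
  "mixture_domain \<Theta> \<phi> J c = eta \<phi> ` \<Theta> \<inter> {y. \<forall>i. i \<notin> J \<longrightarrow> y $ i = c i}"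
  by (auto simp: mixture_domain_def mixture_family_def eta_def)

text \<open>Moving along a free axis leaves the fixed coordinates at \<open>c\<close>, and a short
  move stays in the open range of \<open>eta\<close>.\<close>

lemma mixture_domain_coordinate_ball:
  assumes "y \<in> mixture_domain \<Theta> \<phi> J c" and "j \<in> J"
  obtains d where "d > 0" and "\<And>t. \<bar>t\<bar> < d \<Longrightarrow> y + t *\<^sub>R axis j 1 \<in> mixture_domain \<Theta> \<phi> J c"
proof -
  obtain d where "d > 0" and d: "ball y d \<subseteq> eta \<phi> ` \<Theta>"
    using assms open_eta_range open_contains_ball unfolding mixture_domain_eq by blast
  show thesis
  proof (rule that[OF \<open>d > 0\<close>])
    fix t :: real assume "\<bar>t\<bar> < d"
    then have "y + t *\<^sub>R axis j 1 \<in> ball y d"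
      by (simp add: dist_norm norm_axis_1)
    moreover have "(y + t *\<^sub>R axis j 1) $ i = c i" if "i \<notin> J" for i
      using assms that unfolding mixture_domain_eq by (auto simp: axis_def)
    ultimately show "y + t *\<^sub>R axis j 1 \<in> mixture_domain \<Theta> \<phi> J c"
      using d unfolding mixture_domain_eq by blast
  qed
qed

text \<open>Formally, the product rule would add terms containing derivatives of \<open>W\<close>.
  The sign of \<open>D_Omega\<close> excludes them: \<open>W y\<close> is a subgradient at
  \<open>y\<close>, and two-sided partial derivatives leave no other slope along the free
  axes.\<close>

lemma partial_objective:
  assumes part: "has_partial j (objective W) y"
    and mon: "\<forall>\<theta>\<in>mixture_family \<Theta> \<phi> J c. \<forall>\<theta>'\<in>mixture_family \<Theta> \<phi> J c. D_Omega \<phi> W \<theta> \<theta>' \<ge> 0"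
    and y: "y \<in> mixture_domain \<Theta> \<phi> J c" and "j \<in> J"
  shows "partial j (objective W) y = W y $ j"
proof -
  obtain d where "d > 0" and d: "\<And>t. \<bar>t\<bar> < d \<Longrightarrow> y + t *\<^sub>R axis j 1 \<in> mixture_domain \<Theta> \<phi> J c"
    using y \<open>j \<in> J\<close> mixture_domain_coordinate_ball by metis
  \<comment> \<open>This is \<open>D_Omega\<close> at the parameters of \<open>z\<close> and
    \<open>y\<close>.\<close>
  have sub: "objective W z \<ge> z \<bullet> W y" if "z \<in> mixture_domain \<Theta> \<phi> J c" for z
    using mon y that by (auto simp: mixture_domain_def D_Omega_inner)
  show ?thesis
  proof (rule partial_eq_subgradient[OF part \<open>d > 0\<close>])
    fix t :: real assume "\<bar>t\<bar> < d"
    then have "objective W (y + t *\<^sub>R axis j 1) \<ge> (y + t *\<^sub>R axis j 1) \<bullet> W y"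
      by (intro sub d)
    moreover have "objective W y = y \<bullet> W y"
      by (simp add: objective_def inner_vec_def)
    ultimately show "objective W (y + t *\<^sub>R axis j 1) \<ge> objective W y + t * W y $ j"
      by (simp add: inner_add_left inner_axis')
  qed
qed

text \<open>Moving the reference point from \<open>\<theta>\<close> to
  \<open>F_map \<phi> W \<gamma> \<theta>\<close> changes the divergence by a term linear in
  \<open>eta \<phi> \<tau>\<close> and a constant. On the mixture family only the free coordinates
  of that linear term vary, and there it is the gradient term of mirror descent.\<close>

lemma ab_step_iff_md_step:
  assumes part: "\<forall>y\<in>mixture_domain \<Theta> \<phi> J c. \<forall>j\<in>J. has_partial j (objective W) y"
    and "\<gamma> > 0"
    and mon: "\<forall>\<theta>\<in>mixture_family \<Theta> \<phi> J c. \<forall>\<theta>'\<in>mixture_family \<Theta> \<phi> J c. D_Omega \<phi> W \<theta> \<theta>' \<ge> 0"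
    and \<theta>: "\<theta> \<in> mixture_family \<Theta> \<phi> J c" and \<theta>': "\<theta>' \<in> mixture_family \<Theta> \<phi> J c"
  shows "ab_step \<Theta> \<phi> J c W \<gamma> \<theta> \<theta>' \<longleftrightarrow> md_step \<Theta> \<phi> J c W (1 / \<gamma>) (eta \<phi> \<theta>) (eta \<phi> \<theta>')"
proof -
  let ?M = "mixture_family \<Theta> \<phi> J c" and ?w = "W (eta \<phi> \<theta>)"
  let ?F = "F_map \<phi> W \<gamma> \<theta>"
  \<comment> \<open>The factor \<open>1 / (1 / \<gamma>)\<close> is left unsimplified to match
    \<open>md_step\<close> at step size \<open>1 / \<gamma>\<close>.\<close>
  let ?md = "\<lambda>z. (\<Sum>j\<in>J. z $ j * partial j (objective W) (eta \<phi> \<theta>))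
            + (1 / (1 / \<gamma>)) * bregman_div \<phi> (theta_of \<Theta> \<phi> z) (theta_of \<Theta> \<phi> (eta \<phi> \<theta>))"
  have "eta \<phi> \<theta> \<in> mixture_domain \<Theta> \<phi> J c"
    using \<theta> by (simp add: mixture_domain_def)
  then have grad: "partial j (objective W) (eta \<phi> \<theta>) = ?w $ j" if "j \<in> J" for j
    using part mon that by (intro partial_objective) auto
  \<comment> \<open>The additive constant, free of \<open>\<tau>\<close>, collects the change of
    \<open>\<phi>\<close> at the reference point and the contribution of the fixed
    coordinates.\<close>
  have "?md (eta \<phi> \<tau>) = \<gamma> * bregman_div \<phi> \<tau> ?F
          + (\<gamma> * (\<phi> \<theta> - \<phi> ?F) - (\<Sum>j\<in>-J. c j * ?w $ j))" if \<tau>: "\<tau> \<in> ?M" for \<tau>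
  proof -
    have "eta \<phi> \<tau> \<bullet> ?w = (\<Sum>j\<in>J. eta \<phi> \<tau> $ j * ?w $ j) + (\<Sum>j\<in>-J. eta \<phi> \<tau> $ j * ?w $ j)"
      using sum.union_disjoint[of J "-J" "\<lambda>j. eta \<phi> \<tau> $ j * ?w $ j"] by (simp add: inner_vec_def)
    moreover have "(\<Sum>j\<in>-J. eta \<phi> \<tau> $ j * ?w $ j) = (\<Sum>j\<in>-J. c j * ?w $ j)"
      using \<tau> by (intro sum.cong) (auto simp: mixture_family_def eta_def)
    ultimately have lin: "(\<Sum>j\<in>J. eta \<phi> \<tau> $ j * partial j (objective W) (eta \<phi> \<theta>))
        = eta \<phi> \<tau> \<bullet> ?w - (\<Sum>j\<in>-J. c j * ?w $ j)"
      using grad by simp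
    have "\<tau> \<in> \<Theta>" "\<theta> \<in> \<Theta>"
      using \<tau> \<theta> by (auto simp: mixture_family_def)
    moreover have "\<gamma> * bregman_div \<phi> \<tau> ?F
        = \<gamma> * bregman_div \<phi> \<tau> \<theta> + eta \<phi> \<tau> \<bullet> ?w + \<gamma> * (\<phi> ?F - \<phi> \<theta>)"
    proof -
      have "\<tau> - ?F = (\<tau> - \<theta>) + (1 / \<gamma>) *\<^sub>R ?w"
        by (simp add: F_map_def Omega_def)
      then have "eta \<phi> \<tau> \<bullet> (\<tau> - ?F) = eta \<phi> \<tau> \<bullet> (\<tau> - \<theta>) + (eta \<phi> \<tau> \<bullet> ?w) / \<gamma>"
        by (simp only: inner_add_right inner_scaleR_right) simp
      then show ?thesis
        using \<open>\<gamma> > 0\<close> unfolding bregman_div_inner by (simp add: field_simps)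
    qed
    ultimately show ?thesis
      using lin by (simp add: theta_of_eta algebra_simps)
  qed
  then have "ab_step \<Theta> \<phi> J c W \<gamma> \<theta> \<theta>' \<longleftrightarrow> is_arg_min (\<lambda>\<tau>. ?md (eta \<phi> \<tau>)) (\<lambda>\<tau>. \<tau> \<in> ?M) \<theta>'"
    unfolding ab_step_def e_projection_def using \<open>\<gamma> > 0\<close> by (rule is_arg_min_affine_iff)
  \<comment> \<open>Injectivity of \<open>eta\<close> carries the minimization from the family to
    its image.\<close>
  also have "\<dots> \<longleftrightarrow> md_step \<Theta> \<phi> J c W (1 / \<gamma>) (eta \<phi> \<theta>) (eta \<phi> \<theta>')"
    unfolding md_step_def mixture_domain_def
    by (rule is_arg_min_image_iff[OF inj_on_eta_mixture \<theta>', symmetric])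
  finally show ?thesis .
qed

end

section \<open>From equivalent steps to a bijection between runs\<close>

lemma bij_betw_conjugate_sequences:
  fixes h :: "'a \<Rightarrow> 'b"
  assumes inj: "inj_on h A"
    and R: "\<And>x x'. R x x' \<Longrightarrow> x' \<in> A" and S: "\<And>y y'. S y y' \<Longrightarrow> y' \<in> h ` A"
    and iff: "\<And>x x'. x \<in> A \<Longrightarrow> x' \<in> A \<Longrightarrow> R x x' \<longleftrightarrow> S (h x) (h x')"
  shows "bij_betw (\<lambda>s t. h (s t)) {s. s 0 \<in> A \<and> (\<forall>t. R (s t) (s (Suc t)))}
    {u. u 0 \<in> h ` A \<and> (\<forall>t::nat. S (u t) (u (Suc t)))}" (is "bij_betw ?h ?X ?Y")
proof (rule bij_betw_imageI)
  \<comment> \<open>Index 0 lies in \<open>A\<close> by the start condition, every later index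
    because a step lands in \<open>A\<close>.\<close>
  have X: "s t \<in> A" if "s \<in> ?X" for s t
    using that R by (cases t) auto
  have Y: "u t \<in> h ` A" if "u \<in> ?Y" for u t
    using that S by (cases t) auto
  show "inj_on ?h ?X"
  proof (intro inj_onI ext)
    fix s s' t assume s: "s \<in> ?X" "s' \<in> ?X" "?h s = ?h s'"
    from s(3) have "h (s t) = h (s' t)" by (rule fun_cong)
    then show "s t = s' t" using inj X s(1,2) by (meson inj_onD)
  qed
  show "?h ` ?X = ?Y"
  proof (intro equalityI subsetI)
    fix u assume "u \<in> ?h ` ?X"
    then obtain s where s: "s \<in> ?X" and u: "u = ?h s" by blast
    have "S (h (s t)) (h (s (Suc t)))" for t
      using s X[OF s] iff by auto
    then show "u \<in> ?Y" using s u by auto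
  next
    fix u assume u: "u \<in> ?Y"
    \<comment> \<open>The preimage run is obtained by pulling \<open>u\<close> back term by
      term.\<close>
    define s where "s t = inv_into A h (u t)" for t
    have s: "s t \<in> A" "h (s t) = u t" for t
      using Y[OF u] by (simp_all add: s_def inv_into_into f_inv_into_f)
    have "R (s t) (s (Suc t))" for t
      using u s iff by auto
    then have "s \<in> ?X" using s by simp
    moreover have "u = ?h s" using s by auto
    ultimately show "u \<in> ?h ` ?X" by blast
  qed
qed

text \<open>Steps are relations, so agreement is asserted for single steps and for whole runs
  without presupposing that minimizers exist. A single \<open>\<beta>\<close>, chosen before the
  iterates, serves all of them.\<close>

theorem theorem6:
  fixes \<Theta> :: "(real^'d) set" and \<phi> :: "real^'d \<Rightarrow> real"
    and J :: "'d set" and c :: "'d \<Rightarrow> real"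
    and W :: "real^'d \<Rightarrow> real^'d" and \<gamma> :: real
  assumes "open \<Theta>" and "convex \<Theta>"
    and "C2_on \<Theta> \<phi>" and "strictly_convex_on \<Theta> \<phi>"
    and "convex (mixture_domain \<Theta> \<phi> J c)"
    and "\<forall>y\<in>mixture_domain \<Theta> \<phi> J c. \<forall>j\<in>J. has_partial j (objective W) y"
    and "\<gamma> > 0"
    and "\<forall>\<theta>\<in>mixture_family \<Theta> \<phi> J c. F_map \<phi> W \<gamma> \<theta> \<in> \<Theta>"
    and "\<forall>\<theta>\<in>mixture_family \<Theta> \<phi> J c. \<forall>\<theta>'\<in>mixture_family \<Theta> \<phi> J c. D_Omega \<phi> W \<theta> \<theta>' \<ge> 0"
  shows "\<exists>\<beta>>0.
    (\<forall>\<theta>\<in>mixture_family \<Theta> \<phi> J c. \<forall>\<theta>'\<in>mixture_family \<Theta> \<phi> J c.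
       ab_step \<Theta> \<phi> J c W \<gamma> \<theta> \<theta>' \<longleftrightarrow> md_step \<Theta> \<phi> J c W \<beta> (eta \<phi> \<theta>) (eta \<phi> \<theta>')) \<and>
    bij_betw (\<lambda>\<theta> t. eta \<phi> (\<theta> t))
      {\<theta>. ab_sequence \<Theta> \<phi> J c W \<gamma> \<theta>} {y. md_sequence \<Theta> \<phi> J c W \<beta> y}"
proof (intro exI[of _ "1 / \<gamma>"] conjI)
  interpret bregman_system \<Theta> \<phi>
    using assms by unfold_locales
  \<comment> \<open>With step size \<open>1 / \<gamma>\<close> the mirror descent functional weights
    the divergence by exactly \<open>\<gamma>\<close>.\<close>
  show "1 / \<gamma> > 0" using assms by simp
  have iff: "ab_step \<Theta> \<phi> J c W \<gamma> \<theta> \<theta>' \<longleftrightarrow> md_step \<Theta> \<phi> J c W (1 / \<gamma>) (eta \<phi> \<theta>) (eta \<phi> \<theta>')"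
    if "\<theta> \<in> mixture_family \<Theta> \<phi> J c" "\<theta>' \<in> mixture_family \<Theta> \<phi> J c" for \<theta> \<theta>'
    using assms that by (intro ab_step_iff_md_step)
  then show "\<forall>\<theta>\<in>mixture_family \<Theta> \<phi> J c. \<forall>\<theta>'\<in>mixture_family \<Theta> \<phi> J c.
      ab_step \<Theta> \<phi> J c W \<gamma> \<theta> \<theta>' \<longleftrightarrow> md_step \<Theta> \<phi> J c W (1 / \<gamma>) (eta \<phi> \<theta>) (eta \<phi> \<theta>')"
    by blast
  \<comment> \<open>The remaining side conditions, that steps land in the family or its image, hold
    because a minimizer satisfies its own constraint.\<close>
  show "bij_betw (\<lambda>\<theta> t. eta \<phi> (\<theta> t))
      {\<theta>. ab_sequence \<Theta> \<phi> J c W \<gamma> \<theta>} {y. md_sequence \<Theta> \<phi> J c W (1 / \<gamma>) y}"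
    unfolding ab_sequence_def md_sequence_def mixture_domain_def
    by (rule bij_betw_conjugate_sequences[OF inj_on_eta_mixture, where R = "ab_step \<Theta> \<phi> J c W \<gamma>"
          and S = "md_step \<Theta> \<phi> J c W (1 / \<gamma>)", OF _ _ iff])
      (auto simp: ab_step_def e_projection_def md_step_def mixture_domain_def is_arg_min_def)
qed

end
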